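(* Let $ABCD$ be a quadrangle in the Euclidean plane whose diagonals are not parallel, and let $O$ be the intersection point of the lines $AC$ and $BD$. For $\lambda\in\mathbb{R}$ let $K^{\lambda}L^{\lambda}M^{\lambda}N^{\lambda}$ be the homothetic parallelogram of $ABCD$ with ratio $\lambda$. Then the homothetic parallelograms are in perspective from $O$: for all $\lambda_1,\lambda_2\in\mathbb{R}$, each of the triples $(O,K^{\lambda_1},K^{\lambda_2})$, $(O,L^{\lambda_1},L^{\lambda_2})$, $(O,M^{\lambda_1},M^{\lambda_2})$, $(O,N^{\lambda_1},N^{\lambda_2})$ is collinear. Moreover, for all $\lambda_1,\lambda_2\in\mathbb{R}$, $$\frac{|OK^{\lambda_1}|}{|OK^{\lambda_2}|}=\frac{|OL^{\lambda_1}|}{|OL^{\lambda_2}|}=\frac{|OM^{\lambda_1}|}{|OM^{\lambda_2}|}=\frac{|ON^{\lambda_1}|}{|ON^{\lambda_2}|}=\frac{|\lambda_1-1|}{|\lambda_2-1|},$$ where for $\lambda_2=1$ (denominators formally equal to $0$) the equalities are understood in cross-multiplied form, i.e. $|OX^{\lambda_1}|\,|\lambda_2-1|=|OX^{\lambda_2}|\,|\lambda_1-1|$ for $X\in\{K,L,M,N\}$, with $|OX^{\lambda_2}|=0$.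
   Context: A quadrangle $ABCD$ consists of four points $A,B,C,D$ of the Euclidean plane, no three collinear, taken in this cyclic order; its sides are the segments $AB,BC,CD,DA$, and it may be convex, re-entrant (non-convex and not self-intersecting) or crossed (self-intersecting). The lines $AC$ and $BD$ are its diagonals. For points $X,Y$ and $\lambda\in\mathbb{R}$, $X_Y^{\lambda}$ denotes the image of $Y$ under the homothety with center $X$ and ratio $\lambda$, i.e. $X_Y^{\lambda}=X+\lambda(Y-X)$. The homothetic parallelogram of $ABCD$ with ratio $\lambda$ is the parallelogram $K^{\lambda}L^{\lambda}M^{\lambda}N^{\lambda}$ whose vertices are the intersections of lines $K^{\lambda}=A_B^{\lambda}A_D^{\lambda}\cap B_A^{\lambda}B_C^{\lambda}$, $L^{\lambda}=B_A^{\lambda}B_C^{\lambda}\cap C_B^{\lambda}C_D^{\lambda}$, $M^{\lambda}=C_B^{\lambda}C_D^{\lambda}\cap D_A^{\lambda}D_C^{\lambda}$, $N^{\lambda}=D_A^{\lambda}D_C^{\lambda}\cap A_B^{\lambda}A_D^{\lambda}$. Convention for $\lambda=0$: the lines are understood as limits as $\lambda\to0$: $A_B^{0}A_D^{0}$ is the line through $A$ parallel to $BD$, $B_A^{0}B_C^{0}$ the line through $B$ parallel to $AC$, $C_B^{0}C_D^{0}$ the line through $C$ parallel to $BD$, $D_A^{0}D_C^{0}$ the line through $D$ parallel to $AC$. For $\lambda=1$ the parallelogram degenerates to the point $O$. *)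

theory Defs
  imports "HOL-Analysis.Analysis"
begin

type_synonym point = "real^2"

text \<open>
  The order of the vertices matters only through the roles of the sides and diagonals, so
  convex, re-entrant and crossed quadrangles are all covered.
\<close>
definition quadrangle :: "point \<Rightarrow> point \<Rightarrow> point \<Rightarrow> point \<Rightarrow> bool" where
  "quadrangle A B C D \<longleftrightarrow>
     \<not> collinear {A, B, C} \<and> \<not> collinear {A, B, D} \<and>
     \<not> collinear {A, C, D} \<and> \<not> collinear {B, C, D}"

text \<open>The line through \<open>X\<close> and \<open>Y\<close>, assuming \<open>X \<noteq> Y\<close>.\<close>
abbreviation line :: "point \<Rightarrow> point \<Rightarrow> point set" where
  "line X Y \<equiv> affine hull {X, Y}"

text \<open>Unspecified unless the two sets have exactly one point in common.\<close>
definition meet :: "point set \<Rightarrow> point set \<Rightarrow> point" where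
  "meet S T = (THE P. S \<inter> T = {P})"

definition homothety :: "point \<Rightarrow> real \<Rightarrow> point \<Rightarrow> point" where
  "homothety X t Y = X + t *\<^sub>R (Y - X)"

text \<open>
  For \<open>t = 0\<close> both image points coincide with \<open>X\<close>; the line is then, by convention, the
  limit for \<open>t \<rightarrow> 0\<close>, i.e. the line through \<open>X\<close> parallel to \<open>YZ\<close>.
\<close>
definition hom_line :: "point \<Rightarrow> point \<Rightarrow> point \<Rightarrow> real \<Rightarrow> point set" where
  "hom_line X Y Z t =
     (if t = 0 then line X (X + (Z - Y)) else line (homothety X t Y) (homothety X t Z))"

definition hom_K :: "point \<Rightarrow> point \<Rightarrow> point \<Rightarrow> point \<Rightarrow> real \<Rightarrow> point" where
  "hom_K A B C D t = meet (hom_line A B D t) (hom_line B A C t)"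

definition hom_L :: "point \<Rightarrow> point \<Rightarrow> point \<Rightarrow> point \<Rightarrow> real \<Rightarrow> point" where
  "hom_L A B C D t = meet (hom_line B A C t) (hom_line C B D t)"

definition hom_M :: "point \<Rightarrow> point \<Rightarrow> point \<Rightarrow> point \<Rightarrow> real \<Rightarrow> point" where
  "hom_M A B C D t = meet (hom_line C B D t) (hom_line D A C t)"

definition hom_N :: "point \<Rightarrow> point \<Rightarrow> point \<Rightarrow> point \<Rightarrow> real \<Rightarrow> point" where
  "hom_N A B C D t = meet (hom_line D A C t) (hom_line A B D t)"

end

theory Submission
  imports Defs
begin

text \<open>
  Take \<open>O\<close> as origin. The line \<open>hom_line A B D t\<close> is parallel to \<open>BD\<close> and meets \<open>AC\<close> in
  \<open>(1 - t) A\<close>, and \<open>hom_line B A C t\<close> is parallel to \<open>AC\<close> and meets \<open>BD\<close> in \<open>(1 - t) B\<close>.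
  Hence the two lines meet in \<open>(1 - t) (A + B)\<close>, where \<open>A + B \<noteq> 0\<close>; similarly for the
  other three vertices.
\<close>

lemma line_eq_range: "line P Q = range (\<lambda>s. P + s *\<^sub>R (Q - P))"
  by (simp add: affine_hull_2_alt)

lemma in_line_iff: "R \<in> line P Q \<longleftrightarrow> (\<exists>s. R = P + s *\<^sub>R (Q - P))"
  by (auto simp: line_eq_range)

text \<open>For \<open>t \<noteq> 0\<close> the two image points differ by a nonzero multiple of
  \<open>Z - Y\<close>, and that factor is absorbed into the parameter. For \<open>t = 0\<close> the
  base point becomes \<open>X\<close>, which is the limiting convention. So later arguments need no
  case split on \<open>t\<close>.\<close>

lemma hom_line_eq_range:
  "hom_line X Y Z t = range (\<lambda>s. homothety X t Y + s *\<^sub>R (Z - Y))"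
proof (cases "t = 0")
  case True
  then show ?thesis
    by (simp add: hom_line_def homothety_def line_eq_range)
next
  case False
  have dir: "homothety X t Z - homothety X t Y = t *\<^sub>R (Z - Y)"
    by (simp add: homothety_def algebra_simps)
  have "range (\<lambda>s. homothety X t Y + (s * t) *\<^sub>R (Z - Y))
      = (\<lambda>s. homothety X t Y + s *\<^sub>R (Z - Y)) ` range (\<lambda>s. s * t)"
    by (simp add: image_image)
  also have "range (\<lambda>s. s * t) = UNIV"
    using False by (intro surjI[of _ "\<lambda>x. x / t"]) simp
  finally show ?thesis
    using False by (simp add: hom_line_def line_eq_range dir)
qed

text \<open>Lets \<open>meet_hom_line\<close> be applied with a diagonal traversed in either
  direction. At \<open>t = 0\<close> the exchange reverses the direction vector, which negating the
  parameter undoes.\<close>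

lemma hom_line_commute: "hom_line X Y Z t = hom_line X Z Y t"
proof (cases "t = 0")
  case True
  have "\<exists>s'. X + s *\<^sub>R (P - Q) = X + s' *\<^sub>R (Q - P)" for s and P Q :: point
    by (rule exI[of _ "- s"]) (simp add: algebra_simps)
  with True show ?thesis
    by (auto simp: hom_line_def in_line_iff)
next
  case False
  then show ?thesis
    by (simp add: hom_line_def insert_commute)
qed

lemma meet_eqI: "S \<inter> T = {P} \<Longrightarrow> meet S T = P"
  by (auto simp: meet_def)

text \<open>Adding a common multiple of the two directions to \<open>P\<close> stays on both lines,
  so it must give \<open>P\<close> again.\<close>

lemma lines_meet_once_independent:
  assumes "line X X' \<inter> line Y Y' = {P}" "X \<noteq> X'" "Y \<noteq> Y'"
    and eq: "p *\<^sub>R (X' - X) = q *\<^sub>R (Y' - Y)"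
  shows "p = 0" "q = 0"
proof -
  obtain a b where a: "P = X + a *\<^sub>R (X' - X)" and b: "P = Y + b *\<^sub>R (Y' - Y)"
    using assms(1) by (metis Int_iff in_line_iff singletonI)
  have "P + p *\<^sub>R (X' - X) \<in> line X X'"
    unfolding in_line_iff by (rule exI[of _ "a + p"]) (simp add: a algebra_simps)
  moreover have "P + p *\<^sub>R (X' - X) \<in> line Y Y'"
    unfolding in_line_iff eq by (rule exI[of _ "b + q"]) (simp add: b algebra_simps)
  ultimately have "P + p *\<^sub>R (X' - X) = P"
    using assms(1) by blast
  then show "p = 0" "q = 0"
    using assms(2-3) eq by auto
qed

text \<open>One computation for all four vertices: \<open>X\<close>, \<open>Y\<close> are the ends
  of a side, and \<open>X'\<close>, \<open>Y'\<close> the opposite vertices on the diagonals through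
  \<open>X\<close> and \<open>Y\<close>.\<close>

lemma meet_hom_line:
  assumes P: "line X X' \<inter> line Y Y' = {P}" and ne: "X \<noteq> X'" "Y \<noteq> Y'"
  shows "meet (hom_line X Y Y' t) (hom_line Y X X' t) = P + (1 - t) *\<^sub>R ((X - P) + (Y - P))"
    (is "meet ?S ?T = ?R")
proof (rule meet_eqI)
  obtain a b where a: "P = X + a *\<^sub>R (X' - X)" and b: "P = Y + b *\<^sub>R (Y' - Y)"
    using P by (metis Int_iff in_line_iff singletonI)
  \<comment> \<open>With \<open>P\<close> as origin the difference of the two points is
    \<open>(1 - 2 * t) *\<^sub>R Y\<close>, a vector along the diagonal through \<open>Y\<close>;
    \<open>b\<close> converts it to a multiple of \<open>Y' - Y\<close>.\<close>
  have R1: "?R = homothety X t Y + ((2 * t - 1) * b) *\<^sub>R (Y' - Y)"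
  proof -
    have "?R - homothety X t Y = (1 - 2 * t) *\<^sub>R (Y - P)"
      by (simp add: homothety_def vec_eq_iff algebra_simps)
    also have "\<dots> = (1 - 2 * t) *\<^sub>R (- b *\<^sub>R (Y' - Y))"
      using b by simp
    also have "\<dots> = ((2 * t - 1) * b) *\<^sub>R (Y' - Y)"
      by (simp add: left_diff_distrib flip: scaleR_minus_left)
    finally show ?thesis
      unfolding diff_eq_eq by (simp only: add.commute)
  qed
  have R2: "?R = homothety Y t X + ((2 * t - 1) * a) *\<^sub>R (X' - X)"
  proof -
    have "?R - homothety Y t X = (1 - 2 * t) *\<^sub>R (X - P)"
      by (simp add: homothety_def vec_eq_iff algebra_simps)
    also have "\<dots> = (1 - 2 * t) *\<^sub>R (- a *\<^sub>R (X' - X))"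
      using a by simp
    also have "\<dots> = ((2 * t - 1) * a) *\<^sub>R (X' - X)"
      by (simp add: left_diff_distrib flip: scaleR_minus_left)
    finally show ?thesis
      unfolding diff_eq_eq by (simp only: add.commute)
  qed
  have "?R \<in> ?S \<inter> ?T"
    unfolding hom_line_eq_range using R1 R2 by blast
  moreover have "Q = ?R" if Q: "Q \<in> ?S \<inter> ?T" for Q
  proof -
    obtain p q where Q1: "Q = homothety X t Y + q *\<^sub>R (Y' - Y)"
      and Q2: "Q = homothety Y t X + p *\<^sub>R (X' - X)"
      using Q unfolding hom_line_eq_range by blast
    \<comment> \<open>The displacement from the claimed point to \<open>Q\<close> is a multiple of
      each diagonal direction, so independence makes it vanish.\<close>
    have q: "Q = ?R + (q - (2 * t - 1) * b) *\<^sub>R (Y' - Y)"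
      unfolding R1 Q1 by (simp add: scaleR_left_diff_distrib)
    have p: "Q = ?R + (p - (2 * t - 1) * a) *\<^sub>R (X' - X)"
      unfolding R2 Q2 by (simp add: scaleR_left_diff_distrib)
    from p q have "(p - (2 * t - 1) * a) *\<^sub>R (X' - X) = (q - (2 * t - 1) * b) *\<^sub>R (Y' - Y)"
      by (metis add_left_cancel)
    then have "p - (2 * t - 1) * a = 0"
      by (rule lines_meet_once_independent[OF P ne])
    with p show ?thesis by simp
  qed
  ultimately show "?S \<inter> ?T = {?R}" by blast
qed

text \<open>Otherwise \<open>P\<close> would be the midpoint of \<open>X\<close> and
  \<open>Y\<close>, and \<open>X\<close>, the reflection of \<open>Y\<close> in \<open>P\<close>,
  would lie on the line \<open>Y Y'\<close>. This allows the norm to be cancelled in the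
  ratios.\<close>

lemma vertex_direction_nonzero:
  assumes P: "line X X' \<inter> line Y Y' = {P}" and X: "X \<notin> line Y Y'"
  shows "(X - P) + (Y - P) \<noteq> 0"
proof
  assume "(X - P) + (Y - P) = 0"
  then have XP: "X = Y + 2 *\<^sub>R (P - Y)"
    by (simp add: algebra_simps scaleR_2)
  obtain b where "P = Y + b *\<^sub>R (Y' - Y)"
    using P by (metis Int_iff in_line_iff singletonI)
  then have "X = Y + (2 * b) *\<^sub>R (Y' - Y)"
    using XP by simp
  with X show False
    by (auto simp: in_line_iff)
qed

lemma in_line_imp_collinear:
  assumes "X \<in> line Y Z"
  shows "collinear {X, Y, Z}"
  using assms by (metis collinear_affine_hull empty_subsetI hull_subset insert_subset)

text \<open>Supplies the unique common point without which \<open>meet\<close> is unspecified.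
  Non-parallelism makes the directions linearly independent, so their determinant is
  nonzero.\<close>

lemma nonparallel_lines_meet_once:
  assumes np: "\<not> affine_parallel (line A C) (line B D)" and ne: "A \<noteq> C" "B \<noteq> D"
  obtains P where "line A C \<inter> line B D = {P}"
proof -
  define u v w where "u = C - A" and "v = D - B" and "w = B - A"
  define det where "det = u $ 1 * v $ 2 - u $ 2 * v $ 1"
  have nz: "u \<noteq> 0" "v \<noteq> 0"
    using ne by (auto simp: u_def v_def)
  \<comment> \<open>Were the directions proportional, translation by \<open>B - A\<close> would
    carry one line onto the other.\<close>
  have not_mult: "v \<noteq> k *\<^sub>R u" for k
  proof
    assume k: "v = k *\<^sub>R u"
    then have "k \<noteq> 0"
      using nz by auto
    have "line B D = (\<lambda>x. (B - A) + x) ` line A C"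
    proof (intro equalityI subsetI)
      fix x assume "x \<in> line B D"
      then obtain s where "x = B + s *\<^sub>R v"
        by (auto simp: in_line_iff v_def)
      then have "x = (B - A) + (A + (s * k) *\<^sub>R u)"
        by (simp add: k)
      moreover have "A + (s * k) *\<^sub>R u \<in> line A C"
        by (auto simp: in_line_iff u_def)
      ultimately show "x \<in> (\<lambda>x. (B - A) + x) ` line A C"
        by blast
    next
      fix x assume "x \<in> (\<lambda>x. (B - A) + x) ` line A C"
      then obtain y where "y \<in> line A C" and "x = (B - A) + y"
        by blast
      then obtain s where "y = A + s *\<^sub>R u"
        by (auto simp: in_line_iff u_def)
      then have "x = B + s *\<^sub>R u"
        using \<open>x = (B - A) + y\<close> by simp
      then have "x = B + (s / k) *\<^sub>R v"
        using \<open>k \<noteq> 0\<close> by (simp add: k)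
      then show "x \<in> line B D"
        by (auto simp: in_line_iff v_def)
    qed
    with np show False
      by (auto simp: affine_parallel_def)
  qed
  have det: "det \<noteq> 0"
  proof
    assume "det = 0"
    then have d: "u $ 1 * v $ 2 = u $ 2 * v $ 1"
      by (simp add: det_def)
    consider "u $ 1 \<noteq> 0" | "u $ 2 \<noteq> 0"
      using nz by (auto simp: vec_eq_iff forall_2)
    then show False
    proof cases
      case 1
      then have "v = (v $ 1 / u $ 1) *\<^sub>R u"
        using d by (simp add: vec_eq_iff forall_2 field_simps)
      with not_mult show False by blast
    next
      case 2
      then have "v = (v $ 2 / u $ 2) *\<^sub>R u"
        using d by (simp add: vec_eq_iff forall_2 field_simps)
      with not_mult show False by blast
    qed
  qed
  \<comment> \<open>Cramer's rule for \<open>p u - q v = w\<close>.\<close>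
  define p q where "p = (w $ 1 * v $ 2 - w $ 2 * v $ 1) / det"
    and "q = (w $ 1 * u $ 2 - w $ 2 * u $ 1) / det"
  have pq: "p *\<^sub>R u - q *\<^sub>R v = w"
  proof -
    \<comment> \<open>Multiplying by \<open>det\<close> clears the denominators and leaves a
      polynomial identity in each coordinate.\<close>
    have "det * (p * u $ i - q * v $ i) = det * w $ i" for i
    proof -
      have "det * (p * u $ i - q * v $ i) = (det * p) * u $ i - (det * q) * v $ i"
        by (simp add: algebra_simps)
      also have "\<dots> = (w $ 1 * v $ 2 - w $ 2 * v $ 1) * u $ i
          - (w $ 1 * u $ 2 - w $ 2 * u $ 1) * v $ i"
        using det by (simp add: p_def q_def)
      also have "\<dots> = det * w $ i"
        using exhaust_2[of i] by (auto simp: det_def algebra_simps)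
      finally show ?thesis .
    qed
    with det show ?thesis
      by (simp add: vec_eq_iff)
  qed
  have "A + p *\<^sub>R u = B + q *\<^sub>R v"
    using pq by (simp add: w_def algebra_simps)
  then have mem: "A + p *\<^sub>R u \<in> line A C \<inter> line B D"
    by (metis IntI in_line_iff u_def v_def)
  have "Q = A + p *\<^sub>R u" if Q: "Q \<in> line A C \<inter> line B D" for Q
  proof -
    obtain s t where s: "Q = A + s *\<^sub>R u" and t: "Q = B + t *\<^sub>R v"
      using Q by (metis IntD1 IntD2 in_line_iff u_def v_def)
    have "(t - q) *\<^sub>R v = Q - (B + q *\<^sub>R v)"
      by (simp add: t scaleR_left_diff_distrib)
    also have "\<dots> = Q - (A + p *\<^sub>R u)"
      by (simp only: \<open>A + p *\<^sub>R u = B + q *\<^sub>R v\<close>)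
    also have "\<dots> = (s - p) *\<^sub>R u"
      by (simp add: s scaleR_left_diff_distrib)
    finally have eq: "(t - q) *\<^sub>R v = (s - p) *\<^sub>R u" .
    have "t - q = 0"
    proof (rule ccontr)
      assume "t - q \<noteq> 0"
      then have "v = ((s - p) / (t - q)) *\<^sub>R u"
        using eq by (simp add: eq_vector_fraction_iff)
      with not_mult show False by blast
    qed
    then show ?thesis
      using t \<open>A + p *\<^sub>R u = B + q *\<^sub>R v\<close> by simp
  qed
  with mem have "line A C \<inter> line B D = {A + p *\<^sub>R u}"
    by blast
  then show thesis by (rule that)
qed

theorem theorem2:
  fixes A B C D O' :: point and K L M N :: "real \<Rightarrow> point"
  assumes "quadrangle A B C D"
    and "\<not> affine_parallel (line A C) (line B D)"
    and "O' = meet (line A C) (line B D)"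
    and "K = hom_K A B C D" and "L = hom_L A B C D"
    and "M = hom_M A B C D" and "N = hom_N A B C D"
  shows "(\<forall>l1 l2. collinear {O', K l1, K l2} \<and> collinear {O', L l1, L l2} \<and>
                  collinear {O', M l1, M l2} \<and> collinear {O', N l1, N l2}) \<and>
         (\<forall>l1 l2. l2 \<noteq> 1 \<longrightarrow>
            dist O' (K l1) / dist O' (K l2) = dist O' (L l1) / dist O' (L l2) \<and>
            dist O' (L l1) / dist O' (L l2) = dist O' (M l1) / dist O' (M l2) \<and>
            dist O' (M l1) / dist O' (M l2) = dist O' (N l1) / dist O' (N l2) \<and>
            dist O' (N l1) / dist O' (N l2) = \<bar>l1 - 1\<bar> / \<bar>l2 - 1\<bar>) \<and>
         (\<forall>l1 l2. l2 = 1 \<longrightarrow>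
            (\<forall>X \<in> {K, L, M, N}.
               dist O' (X l1) * \<bar>l2 - 1\<bar> = dist O' (X l2) * \<bar>l1 - 1\<bar> \<and>
               dist O' (X l2) = 0))"
proof -
  have ne: "A \<noteq> C" "B \<noteq> D"
    and off: "A \<notin> line B D" "B \<notin> line A C" "C \<notin> line B D" "D \<notin> line A C"
    using assms(1) unfolding quadrangle_def
    by (auto dest!: in_line_imp_collinear simp: insert_commute)
  obtain P where P: "line A C \<inter> line B D = {P}"
    using nonparallel_lines_meet_once[OF assms(2) ne] .
  then have O': "O' = P"
    using assms(3) meet_eqI by blast
  have CA: "line C A = line A C" and DB: "line D B = line B D"
    by (simp_all add: insert_commute)
  have K: "K t = O' + (1 - t) *\<^sub>R ((A - O') + (B - O'))" for t
    unfolding assms(4) hom_K_def O' by (rule meet_hom_line[OF P ne])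
  \<comment> \<open>The remaining vertices come from the same lemma by moving cyclically round the
    quadrangle, after reversing diagonals where necessary.\<close>
  have L: "L t = O' + (1 - t) *\<^sub>R ((B - O') + (C - O'))" for t
    using meet_hom_line[of B D C A P t] P ne
    by (simp add: assms(5) hom_L_def O' CA Int_commute hom_line_commute[of B A C])
  have M: "M t = O' + (1 - t) *\<^sub>R ((C - O') + (D - O'))" for t
    using meet_hom_line[of C A D B P t] P ne
    by (simp add: assms(6) hom_M_def O' CA DB hom_line_commute[of C B D] hom_line_commute[of D A C])
  have N: "N t = O' + (1 - t) *\<^sub>R ((D - O') + (A - O'))" for t
    using meet_hom_line[of D B A C P t] P ne
    by (simp add: assms(7) hom_N_def O' DB Int_commute hom_line_commute[of A B D])
  have nz: "(A - O') + (B - O') \<noteq> 0" "(B - O') + (C - O') \<noteq> 0"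
      "(C - O') + (D - O') \<noteq> 0" "(D - O') + (A - O') \<noteq> 0"
    using vertex_direction_nonzero[of A C B D P] vertex_direction_nonzero[of B D C A P]
      vertex_direction_nonzero[of C A D B P] vertex_direction_nonzero[of D B A C P] P off
    by (simp_all add: O' CA DB Int_commute)
  have col: "collinear {O', O' + a *\<^sub>R w, O' + b *\<^sub>R w}" for a b and w :: point
  proof -
    have "\<exists>c. (O' + s *\<^sub>R w) - (O' + t *\<^sub>R w) = c *\<^sub>R w" for s t
      by (rule exI[of _ "s - t"]) (simp add: scaleR_left_diff_distrib)
    \<comment> \<open>The zero parameters cover the differences that involve \<open>O'\<close>
      itself.\<close>
    from this[of 0] this[of _ 0] this show ?thesis
      unfolding collinear_def by (intro exI[of _ w]) auto
  qed
  have dist: "dist O' (O' + (1 - t) *\<^sub>R w) = \<bar>t - 1\<bar> * norm w" for t and w :: point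
    by (simp add: dist_norm abs_minus_commute)
  \<comment> \<open>At \<open>t = 1\<close> both sides are quotients by \<open>0\<close>, hence
    \<open>0\<close> by convention.\<close>
  have ratio: "dist O' (O' + (1 - s) *\<^sub>R w) / dist O' (O' + (1 - t) *\<^sub>R w) = \<bar>s - 1\<bar> / \<bar>t - 1\<bar>"
    if "w \<noteq> 0" for s t and w :: point
    using that by (simp only: dist) simp
  show ?thesis
    using col by (simp only: K L M N ratio[OF nz(1)] ratio[OF nz(2)] ratio[OF nz(3)] ratio[OF nz(4)])
      (auto simp: K L M N)
qed

end
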